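(* Let $G$ be a graph on $n \geq 4$ vertices such that $d(x) + d(y) \geq n$ for every induced subgraph $H$ of $G$ that is isomorphic to $K_{1,2} \cup K_1$, or to a graph of the form $(K_{1,2} \cup K_1) + e$, or to $K_{1,3} + e$, and for every pair of distinct nonadjacent vertices $x, y$ of $H$. If $G$ has a vertex $v$ with $d(v) \geq 2$, then $G$ is Hamiltonian.
   Context: All graphs are finite and undirected, with no loops or multiple edges. For a vertex $v$ of $G$, $d(v)$ denotes the degree of $v$ in $G$ (not in the induced subgraph). $K_m$ is the complete graph on $m$ vertices, $K_{m,n}$ is the complete bipartite graph with parts of sizes $m$ and $n$, $\cup$ denotes disjoint union of graphs, and $W + e$ denotes a graph obtained from $W$ by adding an edge $e$ joining two nonadjacent vertices of $W$; "a graph of the form $W+e$" ranges over all choices of such an edge $e$. A graph is Hamiltonian if it contains a Hamilton cycle, i.e. a simple cycle passing through all vertices of the graph. (By the convention used, a single vertex and a single edge count as cycles of order 1 and 2, respectively; since $n \ge 4$ here, a Hamilton cycle is a spanning cycle in the usual sense.) *)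

theory Defs
  imports "Graph_Theory.Graph_Theory"
begin

text \<open>
  A finite simple undirected graph is represented by a \<open>pair_graph\<close>: a finite, irreflexive,
  symmetric set of arcs between vertices, each undirected edge being the two arcs \<open>(u, v)\<close> and
  \<open>(v, u)\<close>.  Hence the number of edges at a vertex is its \<open>out_degree\<close>.
\<close>

abbreviation degree :: "('a, 'b) pre_digraph \<Rightarrow> 'a \<Rightarrow> nat" where
  "degree G v \<equiv> out_degree G v"

definition disjoint_union_of ::
  "'a pair_pre_digraph \<Rightarrow> 'a pair_pre_digraph \<Rightarrow> 'a pair_pre_digraph \<Rightarrow> bool" where
  "disjoint_union_of A B W \<longleftrightarrow>
     pverts A \<inter> pverts B = {} \<and> with_proj W = Digraph_Component.union (with_proj A) (with_proj B)"

definition add_edge :: "'a pair_pre_digraph \<Rightarrow> 'a \<Rightarrow> 'a \<Rightarrow> 'a pair_pre_digraph" where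
  "add_edge W u v = \<lparr> pverts = pverts W, parcs = parcs W \<union> {(u, v), (v, u)} \<rparr>"

text \<open>\<open>plus_edge W W'\<close>: the graph \<open>W'\<close> is of the form \<open>W + e\<close>.\<close>

definition plus_edge :: "'a pair_pre_digraph \<Rightarrow> 'a pair_pre_digraph \<Rightarrow> bool" where
  "plus_edge W W' \<longleftrightarrow>
     (\<exists>u\<in>pverts W. \<exists>v\<in>pverts W. u \<noteq> v \<and> (u, v) \<notin> parcs W \<and> W' = add_edge W u v)"

text \<open>
  Like \<open>complete_digraph\<close> and \<open>complete_bipartite_digraph\<close>, the following predicates describe
  all copies of the respective graph.
\<close>

definition K12_K1 :: "'a pair_pre_digraph \<Rightarrow> bool" where
  "K12_K1 W \<longleftrightarrow>
     (\<exists>A B. K\<^bsub>1,2\<^esub> (with_proj A) \<and> K\<^bsub>1\<^esub> (with_proj B) \<and> disjoint_union_of A B W)"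

definition K12_K1_plus_edge :: "'a pair_pre_digraph \<Rightarrow> bool" where
  "K12_K1_plus_edge W' \<longleftrightarrow> (\<exists>W. K12_K1 W \<and> plus_edge W W')"

definition K13_plus_edge :: "'a pair_pre_digraph \<Rightarrow> bool" where
  "K13_plus_edge W' \<longleftrightarrow> (\<exists>W. K\<^bsub>1,3\<^esub> (with_proj W) \<and> plus_edge W W')"

text \<open>
  The closed walk \<open>u, v, u\<close> is a \<open>cycle\<close> of a symmetric digraph, so a single edge counts as a cycle
  of order 2.  A single vertex counts as a cycle of order 1, but the library's cycles are nonempty
  arc lists, so this case is listed separately.  A cycle visiting three or more vertices is a cycle
  in the usual sense.
\<close>

definition hamiltonian :: "('a, 'b) pre_digraph \<Rightarrow> bool" where
  "hamiltonian G \<longleftrightarrow>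
     card (verts G) = 1 \<or> (\<exists>p. pre_digraph.cycle G p \<and> tail G ` set p = verts G)"

end

theory Submission
  imports Defs
begin

text \<open>
  The hypothesis looks local, but together with a vertex of degree at least two it already gives
  Ore's condition: any two distinct nonadjacent vertices \<open>x\<close>, \<open>y\<close> satisfy \<open>d(x) + d(y) \<ge> n\<close>.  The
  conclusion is then Ore's theorem.

  The five graphs in the hypothesis (\<open>K\<^sub>1\<^sub>,\<^sub>2 \<union> K\<^sub>1\<close>, triangle with an isolated vertex, \<open>P\<^sub>4\<close>, \<open>K\<^sub>1\<^sub>,\<^sub>3\<close>
  and \<open>K\<^sub>1\<^sub>,\<^sub>3 + e\<close>) are exactly the graphs on four vertices that contain a path with two edges, except
  \<open>C\<^sub>4\<close>, \<open>K\<^sub>4\<close> minus an edge, and \<open>K\<^sub>4\<close>.  So let \<open>x\<close>, \<open>y\<close> be nonadjacent with small degree sum.  Four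
  vertices that include \<open>x\<close> and \<open>y\<close> and contain a path with two edges induce \<open>C\<^sub>4\<close> or \<open>K\<^sub>4\<close> minus
  an edge, and in both cases the other two vertices are adjacent to both \<open>x\<close> and \<open>y\<close>.
  If \<open>x\<close> and \<open>y\<close> have a common neighbour, every other vertex is therefore adjacent to both, and the degree sum is \<open>2(n - 2) \<ge> n\<close>.  If they have none, no path with two edges lies
  on four vertices that include both.  This makes \<open>x\<close>, \<open>y\<close> and all their neighbours have degree at
  most one, so a vertex \<open>v\<close> of degree at least two is far from \<open>x\<close>: a path with centre \<open>v\<close> together
  with \<open>x\<close> induces a listed graph, which demands \<open>d(x) + d(v) \<ge> n\<close>, although \<open>x\<close> and \<open>v\<close> have
  disjoint neighbourhoods.  This is \<open>ore_condition_if_local\<close>; that the listed graphs occur where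
  the argument needs them is \<open>four_vertices_induce_listed_graph\<close>.

  Ore's theorem (\<open>ore\<close>) is proved by arranging the vertices in a circle with as few consecutive
  nonadjacent pairs as possible.  If such a pair remained, the degree condition would produce two
  crossing edges, and reversing a segment of the circle would remove the pair.
\<close>

section \<open>Ore's theorem\<close>

fun gaps :: "('a \<Rightarrow> 'a \<Rightarrow> bool) \<Rightarrow> 'a list \<Rightarrow> nat" where
  "gaps E (x # y # zs) = of_bool (\<not> E x y) + gaps E (y # zs)"
| "gaps E _ = 0"

lemma gaps_append:
  assumes "xs \<noteq> []" "ys \<noteq> []"
  shows "gaps E (xs @ ys) = gaps E xs + of_bool (\<not> E (last xs) (hd ys)) + gaps E ys"
  using assms
proof (induction E xs rule: gaps.induct)
  case ("2_2" E v)
  then show ?case by (cases ys) auto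
qed auto

lemma gaps_rev:
  assumes "symp E"
  shows "gaps E (rev xs) = gaps E xs"
proof (induction xs rule: induct_list012)
  case (3 x y zs)
  have "gaps E (rev (x # y # zs)) = gaps E (rev (y # zs) @ [x])"
    by simp
  also have "\<dots> = gaps E (rev (y # zs)) + of_bool (\<not> E y x)"
    by (subst gaps_append) (simp_all add: last_rev)
  finally show ?case
    using 3 assms by (auto simp: symp_def)
qed auto

lemma gaps_eq_0_iff: "gaps E xs = 0 \<longleftrightarrow> successively E xs"
  by (induction E xs rule: gaps.induct) auto

lemma gap_splits_list:
  assumes "\<not> successively E xs"
  obtains us vs where "xs = us @ vs" "us \<noteq> []" "vs \<noteq> []" "\<not> E (last us) (hd vs)"
  using assms
proof (induction xs arbitrary: thesis rule: induct_list012)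
  case (3 x y zs)
  show ?case
  proof (cases "E x y")
    case True
    with 3 obtain us vs where "y # zs = us @ vs" "us \<noteq> []" "vs \<noteq> []" "\<not> E (last us) (hd vs)"
      by auto
    then show ?thesis
      using "3.prems"(1)[of "x # us" vs] by simp
  next
    case False
    then show ?thesis
      using "3.prems"(1)[of "[x]" "y # zs"] by simp
  qed
qed auto

text \<open>
  Ore's exchange on a circular arrangement \<open>xs @ ys\<close>, where repeating the first vertex at the end
  closes the circle.  Reversing \<open>xs\<close> changes only the two joints between \<open>xs\<close> and \<open>ys\<close>: the new
  joints are edges, and one of the old joints was not.
\<close>

lemma gaps_exchange:
  assumes "symp E" "xs \<noteq> []" "ys \<noteq> []"
    and "\<not> E (last ys) (hd xs)" "E (hd xs) (hd ys)" "E (last ys) (last xs)"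
  shows "gaps E (rev xs @ ys @ [last xs]) < gaps E (xs @ ys @ [hd xs])"
  using assms by (simp add: gaps_append gaps_rev hd_rev last_rev)

text \<open>
  Pigeonhole: the positions directly before a neighbour of the first vertex and the positions of
  neighbours of the last vertex are two sets among the \<open>length xs - 1\<close> positions other than the
  last one, and together they have at least \<open>length xs\<close> elements.
\<close>

lemma ore_crossing:
  assumes xs: "distinct xs" "xs \<noteq> []"
    and E: "symp E" "irreflp E" "\<not> E (last xs) (hd xs)"
    and deg: "card {z \<in> set xs. E (hd xs) z} + card {z \<in> set xs. E (last xs) z} \<ge> length xs"
  shows "\<exists>i. Suc i < length xs \<and> E (hd xs) (xs ! Suc i) \<and> E (last xs) (xs ! i)"
proof (rule ccontr)
  assume none: "\<not> ?thesis"
  define m where "m = length xs - 1"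
  have len: "length xs = Suc m"
    using xs by (simp add: m_def)
  define A where "A = {i. i < m \<and> E (hd xs) (xs ! Suc i)}"
  define B where "B = {i. i < m \<and> E (last xs) (xs ! i)}"
  have fin: "finite A" "finite B"
    by (auto simp: A_def B_def)
  have hd: "hd xs = xs ! 0" and last: "last xs = xs ! m"
    using xs len by (auto simp: hd_conv_nth last_conv_nth)
  have "{z \<in> set xs. E (hd xs) z} \<subseteq> (\<lambda>i. xs ! Suc i) ` A"
  proof
    fix z assume "z \<in> {z \<in> set xs. E (hd xs) z}"
    then obtain j where j: "j < Suc m" "z = xs ! j" "E (hd xs) z"
      by (auto simp: in_set_conv_nth len)
    then have "j \<noteq> 0"
      using E(2) hd by (metis irreflpD)
    then obtain i where "j = Suc i"
      using not0_implies_Suc by blast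
    with j show "z \<in> (\<lambda>i. xs ! Suc i) ` A"
      by (auto simp: A_def)
  qed
  then have dx: "card {z \<in> set xs. E (hd xs) z} \<le> card A"
    using fin surj_card_le by blast
  have "{z \<in> set xs. E (last xs) z} \<subseteq> (\<lambda>i. xs ! i) ` B"
  proof
    fix z assume "z \<in> {z \<in> set xs. E (last xs) z}"
    then obtain j where j: "j < Suc m" "z = xs ! j" "E (last xs) z"
      by (auto simp: in_set_conv_nth len)
    then have "j \<noteq> m"
      using E(2) last by (metis irreflpD)
    with j show "z \<in> (\<lambda>i. xs ! i) ` B"
      by (auto simp: B_def)
  qed
  then have dy: "card {z \<in> set xs. E (last xs) z} \<le> card B"
    using fin surj_card_le by blast
  have "A \<inter> B = {}"
    using none by (auto simp: A_def B_def len)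
  then have "card A + card B = card (A \<union> B)"
    using fin by (simp add: card_Un_disjoint)
  also have "\<dots> \<le> card {..<m}"
    by (rule card_mono) (auto simp: A_def B_def)
  finally show False
    using dx dy deg len by simp
qed

theorem ore:
  fixes E :: "'a \<Rightarrow> 'a \<Rightarrow> bool"
  assumes V: "finite V" "card V \<ge> 2"
    and E: "symp E" "irreflp E"
    and deg: "\<And>x y. \<lbrakk>x \<in> V; y \<in> V; x \<noteq> y; \<not> E x y\<rbrakk>
      \<Longrightarrow> card V \<le> card {z \<in> V. E x z} + card {z \<in> V. E y z}"
  shows "\<exists>xs. distinct xs \<and> set xs = V \<and> successively E (xs @ [hd xs])"
proof -
  define arrangement where "arrangement xs \<longleftrightarrow> distinct xs \<and> set xs = V" for xs
  define cost where "cost xs = gaps E (xs @ [hd xs])" for xs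
  obtain xs0 where "arrangement xs0"
    using V finite_distinct_list unfolding arrangement_def by blast
  then obtain xs where xs: "arrangement xs" and least: "\<And>ys. arrangement ys \<Longrightarrow> cost xs \<le> cost ys"
    using ex_has_least_nat[of arrangement xs0 cost] by blast
  have "cost xs = 0"
  proof (rule ccontr)
    assume "cost xs \<noteq> 0"
    then have "\<not> successively E (xs @ [hd xs])"
      by (simp add: cost_def gaps_eq_0_iff)
    have ne: "zs \<noteq> []" if "arrangement zs" for zs
      using that V by (auto simp: arrangement_def)
    \<comment> \<open>Rotating the circle moves a gap to the place where the list closes up.\<close>
    obtain ys where ys: "arrangement ys" "cost ys = cost xs" "\<not> E (last ys) (hd ys)"
    proof (cases "E (last xs) (hd xs)")
      case False
      with that xs show thesis by blast
    next
      case True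
      then have "\<not> successively E xs"
        using \<open>\<not> successively E (xs @ [hd xs])\<close> by (auto simp: successively_append_iff)
      then obtain us vs where split: "xs = us @ vs" "us \<noteq> []" "vs \<noteq> []" "\<not> E (last us) (hd vs)"
        using gap_splits_list by blast
      have "arrangement (vs @ us)"
        using xs split by (auto simp: arrangement_def)
      moreover have "cost (vs @ us) = cost xs"
        using split by (simp add: cost_def gaps_append)
      ultimately show thesis
        using that split by simp
    qed
    have len: "length ys = card V"
      using ys by (auto simp: arrangement_def distinct_card)
    have "hd ys \<noteq> last ys"
    proof
      assume "hd ys = last ys"
      then have "length ys \<le> 1"
        using ys(1) ne[OF ys(1)] by (cases ys) (auto simp: arrangement_def split: if_splits)
      then show False
        using len V(2) by simp
    qed
    moreover have "\<not> E (hd ys) (last ys)"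
      using ys(3) E(1) by (metis sympD)
    ultimately have "length ys \<le> card {z \<in> set ys. E (hd ys) z} + card {z \<in> set ys. E (last ys) z}"
      using deg[of "hd ys" "last ys"] ys(1) ne[OF ys(1)] len by (auto simp: arrangement_def)
    then obtain i where i: "Suc i < length ys" "E (hd ys) (ys ! Suc i)" "E (last ys) (ys ! i)"
      using ore_crossing[OF _ ne[OF ys(1)] E ys(3)] ys(1) by (auto simp: arrangement_def)
    define us vs where "us = take (Suc i) ys" and "vs = drop (Suc i) ys"
    have split: "ys = us @ vs" "us \<noteq> []" "vs \<noteq> []"
      using i(1) by (auto simp: us_def vs_def)
    have ends: "last us = ys ! i" "hd vs = ys ! Suc i"
      using i(1) by (auto simp: us_def vs_def take_Suc_conv_app_nth hd_drop_conv_nth)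
    have "cost (rev us @ vs) < cost ys"
      using gaps_exchange[OF E(1) split(2,3)] ys(3) i ends split
      by (simp add: cost_def hd_rev hd_append)
    moreover have "arrangement (rev us @ vs)"
      using ys(1) split by (auto simp: arrangement_def)
    ultimately show False
      using least ys(2) by fastforce
  qed
  with xs show ?thesis
    by (auto simp: arrangement_def cost_def gaps_eq_0_iff)
qed

lemma pawalk_zip:
  "pcas u (zip (u # ys) (ys @ [w])) w" "pawalk_verts u (zip (u # ys) (ys @ [w])) = u # ys @ [w]"
  by (induction ys arbitrary: u) auto

lemma successively_zip:
  "successively (\<lambda>x y. (x, y) \<in> R) (u # ys @ [w]) \<longleftrightarrow> set (zip (u # ys) (ys @ [w])) \<subseteq> R"
  by (induction ys arbitrary: u) auto

text \<open>
  The arc list of the cycle is obtained by pairing every vertex with its successor on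
  the circle.  In a walk starting and ending at \<open>u\<close>, dropping the first vertex leaves each vertex
  of the circle exactly once.
\<close>

lemma hamiltonian_if_cyclic_arrangement:
  assumes "distinct xs" "xs \<noteq> []" "set xs = pverts G"
    and "successively (\<lambda>x y. (x, y) \<in> parcs G) (xs @ [hd xs])"
  shows "hamiltonian (with_proj G)"
proof -
  interpret pair_pre_digraph G .
  obtain u ys where xs: "xs = u # ys"
    using assms(2) by (cases xs) auto
  let ?p = "zip (u # ys) (ys @ [u])"
  have "pre_digraph.cycle (with_proj G) ?p"
    unfolding pre_digraph.cycle_def pre_digraph.awalk_def
    using assms xs pawalk_zip[of u ys u] successively_zip[of "parcs G" u ys u]
    by (intro exI[of _ u]) (auto simp: cas_with_proj_eq awalk_verts_with_proj_eq)
  moreover have "map fst ?p = xs"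
    using xs by (simp add: map_fst_zip)
  then have "fst ` set ?p = pverts G"
    using assms(3) by (metis set_map)
  ultimately show ?thesis
    unfolding hamiltonian_def by (metis with_proj_simps(1,4))
qed

section \<open>Local degree conditions and Ore's condition\<close>

text \<open>
  The two local assumptions speak of four vertices \<open>a\<close>, \<open>b\<close>, \<open>c\<close>, \<open>d\<close> for which \<open>a - c - b\<close> is a
  path.  In \<open>path\<close> the path is induced, and excluding edges from \<open>d\<close> to both of its ends excludes
  precisely \<open>C\<^sub>4\<close> and \<open>K\<^sub>4\<close> minus the edge \<open>ab\<close>.  In \<open>triangle\<close> the vertex \<open>d\<close> is isolated from a
  triangle.
\<close>

lemma ore_condition_if_local:
  fixes E :: "'a \<Rightarrow> 'a \<Rightarrow> bool"
  defines "deg \<equiv> \<lambda>V x. card {z \<in> V. E x z}"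
  assumes V: "finite V" "card V \<ge> 4"
    and E: "symp E" "irreflp E"
    and path: "\<And>a b c d x y. \<lbrakk>{a, b, c, d} \<subseteq> V; distinct [a, b, c, d]; E c a; E c b; \<not> E a b;
        \<not> (E a d \<and> E b d); x \<in> {a, b, c, d}; y \<in> {a, b, c, d}; x \<noteq> y; \<not> E x y\<rbrakk>
        \<Longrightarrow> card V \<le> deg V x + deg V y"
    and triangle: "\<And>a b c d x y. \<lbrakk>{a, b, c, d} \<subseteq> V; distinct [a, b, c, d]; E c a; E c b; E a b;
        \<not> E a d; \<not> E b d; \<not> E c d; x \<in> {a, b, c, d}; y \<in> {a, b, c, d}; x \<noteq> y; \<not> E x y\<rbrakk>
        \<Longrightarrow> card V \<le> deg V x + deg V y"
    and v: "v \<in> V" "deg V v \<ge> 2"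
    and xy: "x \<in> V" "y \<in> V" "x \<noteq> y" "\<not> E x y"
  shows "card V \<le> deg V x + deg V y"
proof (rule ccontr)
  assume low: "\<not> ?thesis"
  have sym: "E p q \<longleftrightarrow> E q p" for p q
    using E(1) by (metis sympD)
  have irr: "\<not> E p p" for p
    using E(2) by (metis irreflpD)
  have nbrs: "\<exists>a b. a \<in> V \<and> b \<in> V \<and> a \<noteq> b \<and> E u a \<and> E u b" if u: "deg V u \<ge> 2" for u
  proof -
    obtain T where "T \<subseteq> {z \<in> V. E u z}" "card T = 2"
      using u unfolding deg_def by (meson obtain_subset_with_card_n)
    then show ?thesis
      by (auto simp: card_2_iff)
  qed
  have large: "deg V u \<ge> 2" if "a \<in> V" "b \<in> V" "a \<noteq> b" "E u a" "E u b" for u a b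
    unfolding deg_def using that V(1) card_mono[of "{z \<in> V. E u z}" "{a, b}"] by simp
  have disjoint_nbrs: "deg V p + deg V q + 2 \<le> card V"
    if "p \<in> V" "q \<in> V" "p \<noteq> q" "\<not> E p q" "\<And>c. c \<in> V \<Longrightarrow> \<not> (E p c \<and> E q c)" for p q
  proof -
    have "deg V p + deg V q = card ({z \<in> V. E p z} \<union> {z \<in> V. E q z})"
      unfolding deg_def using that(5) V(1) by (subst card_Un_disjoint) auto
    also have "\<dots> + 2 = card ({z \<in> V. E p z} \<union> {z \<in> V. E q z} \<union> {p, q})"
      using that(3,4) V(1) irr sym by (subst card_Un_disjoint[of _ "{p, q}"]) auto
    also have "\<dots> \<le> card V"
      using that(1,2) V(1) by (intro card_mono) auto
    finally show ?thesis .
  qed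
  have isolated: "card V \<le> deg V p + deg V u"
    if "p \<in> V" "u \<in> V" "a \<in> V" "b \<in> V" "a \<noteq> b" "E u a" "E u b" "p \<noteq> u" "\<not> E p u" "\<not> E p a" "\<not> E p b"
    for p u a b
  proof (cases "E a b")
    case True
    then show ?thesis
      using triangle[of a b u p p u] that sym irr by auto
  next
    case False
    then show ?thesis
      using path[of a b u p p u] that sym irr by auto
  qed
  show False
  proof (cases "\<exists>c\<in>V. E x c \<and> E y c")
    case True
    then obtain c where c: "c \<in> V" "E x c" "E y c" by blast
    \<comment> \<open>Otherwise the induced path \<open>x - c - y\<close> and \<open>d\<close> would give the bound for \<open>x\<close> and \<open>y\<close>.\<close>
    have "E x d \<and> E y d" if "d \<in> V - {x, y}" for d
      using path[of x y c d x y] c that xy low sym irr by (cases "d = c") auto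
    then have "V - {x, y} \<subseteq> {z \<in> V. E x z}" "V - {x, y} \<subseteq> {z \<in> V. E y z}"
      by auto
    then have "card (V - {x, y}) \<le> deg V x" "card (V - {x, y}) \<le> deg V y"
      unfolding deg_def using V(1) by (auto intro!: card_mono)
    moreover have "card (V - {x, y}) = card V - 2"
      using xy V(1) by (simp add: card_Diff_subset)
    ultimately show False
      using V(2) low by simp
  next
    case False
    \<comment> \<open>The equation \<open>{p, q} = {x, y}\<close> covers both ways of naming the two vertices.\<close>
    have end_small: "deg V p < 2" if "{p, q} = {x, y}" for p q
    proof (rule ccontr)
      assume "\<not> ?thesis"
      then obtain a b where ab: "a \<in> V" "b \<in> V" "a \<noteq> b" "E p a" "E p b"
        using nbrs[of p] by auto
      have "q \<in> V" "p \<in> V" "q \<noteq> p" "\<not> E q p" "\<not> E q a" "\<not> E q b" "\<not> card V \<le> deg V q + deg V p"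
        using that xy False low sym ab by (auto simp: doubleton_eq_iff add.commute)
      with ab show False
        using isolated[of q p a b] by blast
    qed
    have nbr_small: "deg V u < 2" if "{p, q} = {x, y}" "u \<in> V" "E p u" for p q u
    proof (rule ccontr)
      assume "\<not> ?thesis"
      then obtain a where a: "a \<in> V" "a \<noteq> p" "E u a"
        using nbrs[of u] by (metis not_less)
      have pq: "p \<in> V" "q \<in> V" "p \<noteq> q" "\<not> E p q" "\<not> E u q" "u \<noteq> q" "a \<noteq> q" "\<not> card V \<le> deg V p + deg V q"
        using that xy False low sym a by (auto simp: doubleton_eq_iff add.commute)
      have "deg V p < 2"
        using end_small that(1) .
      then have "\<not> E p a"
        using large[of u a p] that irr a by (auto simp: sym)
      \<comment> \<open>Now \<open>p - u - a\<close> is an induced path, and \<open>q\<close> is adjacent neither to \<open>p\<close> nor to \<open>u\<close>.\<close>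
      then show False
        using path[of p a u q p q] pq a that irr sym by auto
    qed
    obtain a b where ab: "a \<in> V" "b \<in> V" "a \<noteq> b" "E v a" "E v b"
      using nbrs v by blast
    \<comment> \<open>A common neighbour of \<open>x\<close> and \<open>v\<close> would be a neighbour of \<open>x\<close> of degree at least two.\<close>
    have far: "x \<noteq> v" "\<not> E x v" "\<And>c. c \<in> V \<Longrightarrow> \<not> (E x c \<and> E v c)"
    proof -
      show "x \<noteq> v" using end_small[of x y] v(2) by auto
      show "\<not> E x v" using nbr_small[of x y v] v by auto
      fix c assume "c \<in> V"
      show "\<not> (E x c \<and> E v c)"
      proof
        assume c: "E x c \<and> E v c"
        then have "deg V c \<ge> 2"
          using large[of x v c] xy v \<open>x \<noteq> v\<close> sym by auto
        then show False
          using nbr_small[of x y c] c \<open>c \<in> V\<close> by auto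
      qed
    qed
    then have "card V \<le> deg V x + deg V v"
      using isolated[of x v a b] xy v ab by auto
    then show False
      using disjoint_nbrs[of x v] far xy v by auto
  qed
qed

section \<open>The four-vertex graphs\<close>

text \<open>
  Listing each edge in one direction only keeps the edge sets of concrete graphs short, and the
  image of the graph under a vertex map is again of this form.
\<close>

definition sym_graph :: "'a set \<Rightarrow> 'a rel \<Rightarrow> 'a pair_pre_digraph" where
  "sym_graph V S = \<lparr> pverts = V, parcs = S \<union> S\<inverse> \<rparr>"

lemma sym_graph_simps [simp]:
  "pverts (sym_graph V S) = V" "parcs (sym_graph V S) = S \<union> S\<inverse>"
  by (auto simp: sym_graph_def)

lemma pair_graph_sym_graph:
  assumes "finite V" "S \<subseteq> V \<times> V" "irrefl S"
  shows "pair_graph (sym_graph V S)"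
proof
  show "finite (parcs (sym_graph V S))"
    using assms finite_subset[OF assms(2)] by auto
  show "symmetric (with_proj (sym_graph V S))"
    by (auto simp: symmetric_def intro: symI)
qed (use assms in \<open>auto simp: irrefl_def\<close>)

lemma wf_digraph_sym_graph:
  assumes "S \<subseteq> V \<times> V"
  shows "wf_digraph (with_proj (sym_graph V S))"
  by unfold_locales (use assms in auto)

lemma plus_edge_sym_graph:
  assumes "e \<in> V \<times> V" "fst e \<noteq> snd e" "e \<notin> S" "prod.swap e \<notin> S"
  shows "plus_edge (sym_graph V S) (sym_graph V (insert e S))"
proof -
  obtain u v where e: "e = (u, v)"
    by fastforce
  have "sym_graph V (insert e S) = add_edge (sym_graph V S) u v"
    using e by (auto simp: add_edge_def sym_graph_def)
  then show ?thesis
    unfolding plus_edge_def using assms e by auto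
qed

lemma digraph_iso_sym_graph:
  assumes "S \<subseteq> V \<times> V" "inj_on f V"
  shows "digraph_iso (with_proj (sym_graph V S)) (with_proj (sym_graph (f ` V) (map_prod f f ` S)))"
proof -
  let ?h = "\<lparr> iso_verts = f, iso_arcs = map_prod f f, iso_head = snd, iso_tail = fst \<rparr>"
  have "inj_on (map_prod f f) (V \<times> V)"
    using assms(2) by (simp add: map_prod_inj_on)
  then have "inj_on (map_prod f f) (S \<union> S\<inverse>)"
    by (rule inj_on_subset) (use assms in auto)
  then have "pre_digraph.digraph_isomorphism (with_proj (sym_graph V S)) ?h"
    unfolding pre_digraph.digraph_isomorphism_def using assms wf_digraph_sym_graph by auto
  moreover have "with_proj (sym_graph (f ` V) (map_prod f f ` S)) = app_iso ?h (with_proj (sym_graph V S))"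
    by (auto simp: app_iso_def with_proj_def sym_graph_def image_iff Bex_def; force)
  ultimately show ?thesis
    unfolding digraph_iso_def by blast
qed

lemma complete_bipartite_star:
  assumes "finite L" "c \<notin> L"
  shows "K\<^bsub>1,card L\<^esub> (with_proj (sym_graph (insert c L) ({c} \<times> L)))"
proof -
  have "graph (with_proj (sym_graph (insert c L) ({c} \<times> L)))"
    by (intro pair_graph.pair_graphD_graph pair_graph_sym_graph) (use assms in \<open>auto simp: irrefl_def\<close>)
  then show ?thesis
    unfolding complete_bipartite_digraph_def
    using assms by (intro conjI exI[of _ "{c}"] exI[of _ L]) auto
qed

lemma K12_K1_sym_graph:
  assumes "distinct [a, b, c, d]"
  shows "K12_K1 (sym_graph {a, b, c, d} {(c, a), (c, b)})"
proof -
  have "card {a, b} = 2"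
    using assms by simp
  then have "K\<^bsub>1,2\<^esub> (with_proj (sym_graph {c, a, b} ({c} \<times> {a, b})))"
    using complete_bipartite_star[of "{a, b}" c] assms by (simp only: distinct.simps list.set) blast
  moreover have "K\<^bsub>1\<^esub> (with_proj (sym_graph {d} {}))"
    by (auto simp: complete_digraph_pair_def)
  moreover have "disjoint_union_of (sym_graph {c, a, b} ({c} \<times> {a, b})) (sym_graph {d} {})
      (sym_graph {a, b, c, d} {(c, a), (c, b)})"
    using assms by (auto simp: disjoint_union_of_def union_def with_proj_def sym_graph_def)
  ultimately show ?thesis
    unfolding K12_K1_def by blast
qed

lemma K12_K1_plus_edge_sym_graph:
  assumes "distinct [a, b, c, d]" "e \<in> {(a, b), (a, d), (b, d), (c, d)}"
  shows "K12_K1_plus_edge (sym_graph {a, b, c, d} {e, (c, a), (c, b)})"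
proof -
  have "plus_edge (sym_graph {a, b, c, d} {(c, a), (c, b)})
      (sym_graph {a, b, c, d} {e, (c, a), (c, b)})"
    using assms by (intro plus_edge_sym_graph) auto
  then show ?thesis
    unfolding K12_K1_plus_edge_def using K12_K1_sym_graph[OF assms(1)] by blast
qed

lemma K13_plus_edge_sym_graph:
  assumes "distinct [a, b, c, d]" "e \<in> {(a, d), (b, d)}"
  shows "K13_plus_edge (sym_graph {a, b, c, d} {e, (c, a), (c, b), (c, d)})"
proof -
  have "card {a, b, d} = 3"
    using assms by simp
  then have "K\<^bsub>1,3\<^esub> (with_proj (sym_graph {c, a, b, d} ({c} \<times> {a, b, d})))"
    using complete_bipartite_star[of "{a, b, d}" c] assms by (simp only: distinct.simps list.set) blast
  moreover have "plus_edge (sym_graph {c, a, b, d} ({c} \<times> {a, b, d}))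
      (sym_graph {a, b, c, d} {e, (c, a), (c, b), (c, d)})"
    using plus_edge_sym_graph[of e "{c, a, b, d}" "{c} \<times> {a, b, d}"] assms
    by (auto simp: insert_commute)
  ultimately show ?thesis
    unfolding K13_plus_edge_def by blast
qed

text \<open>
  The copy \<open>W\<close> is obtained by numbering \<open>a\<close>, \<open>b\<close>, \<open>c\<close>, \<open>d\<close> as \<open>0\<close>, \<open>1\<close>, \<open>2\<close>, \<open>3\<close>.  Besides the
  path \<open>a - c - b\<close>, the set \<open>X\<close> of edges has at most one element, which gives \<open>K\<^sub>1\<^sub>,\<^sub>2 \<union> K\<^sub>1\<close> or this
  graph plus an edge, or it consists of \<open>cd\<close> and one of \<open>ad\<close>, \<open>bd\<close>, which gives \<open>K\<^sub>1\<^sub>,\<^sub>3 + e\<close> with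
  centre \<open>c\<close>.
\<close>

lemma four_vertices_induce_listed_graph:
  fixes G :: "'a pair_pre_digraph"
  assumes G: "pair_graph G"
    and abcd: "{a, b, c, d} \<subseteq> pverts G" "distinct [a, b, c, d]"
    and star: "(c, a) \<in> parcs G" "(c, b) \<in> parcs G"
    and cases: "(a, b) \<notin> parcs G \<and> \<not> ((a, d) \<in> parcs G \<and> (b, d) \<in> parcs G)
      \<or> (a, b) \<in> parcs G \<and> (a, d) \<notin> parcs G \<and> (b, d) \<notin> parcs G \<and> (c, d) \<notin> parcs G"
  shows "\<exists>H (W :: nat pair_pre_digraph). induced_subgraph (with_proj H) (with_proj G)
    \<and> (K12_K1 W \<or> K12_K1_plus_edge W \<or> K13_plus_edge W) \<and> digraph_iso (with_proj H) (with_proj W)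
    \<and> pverts H = {a, b, c, d} \<and> parcs H \<subseteq> parcs G"
proof -
  interpret pair_graph G by fact
  define F where "F = {a, b, c, d}"
  define X where "X = {(a, b), (a, d), (b, d), (c, d)} \<inter> parcs G"
  define S where "S = {(c, a), (c, b)} \<union> X"
  define H where "H = sym_graph F S"
  have arcs_H: "parcs H = parcs G \<inter> F \<times> F"
  proof
    show "parcs H \<subseteq> parcs G \<inter> F \<times> F"
      using star arcs_symmetric unfolding H_def S_def X_def F_def sym_graph_simps by blast
    have "(p, q) \<in> S \<or> (q, p) \<in> S" if "(p, q) \<in> parcs G" "p \<in> F" "q \<in> F" for p q
      using arcs_symmetric[OF that(1)] no_loops'[OF that(1)] that
      unfolding S_def X_def F_def insert_iff Un_iff Int_iff empty_iff prod.inject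
      by (elim disjE FalseE) simp_all
    then show "parcs G \<inter> F \<times> F \<subseteq> parcs H"
      unfolding H_def by auto
  qed
  have F: "F \<subseteq> pverts G"
    using abcd(1) by (simp add: F_def)
  have verts_H: "pverts H = F"
    by (simp add: H_def)
  have S: "S \<subseteq> F \<times> F"
    unfolding S_def X_def F_def by blast
  have "wf_digraph (with_proj H)"
    unfolding H_def using S by (rule wf_digraph_sym_graph)
  then have "induced_subgraph (with_proj H) (with_proj G)"
    using verts_H arcs_H F wf_digraph_axioms
    by (auto simp: induced_subgraph_def subgraph_def compatible_def)
  moreover
  define f :: "'a \<Rightarrow> nat" where "f v = (if v = a then 0 else if v = b then 1 else if v = c then 2 else 3)" for v
  have f: "f a = 0" "f b = 1" "f c = 2" "f d = 3"
    using abcd by (auto simp: f_def)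
  have "inj_on f F"
    using f by (auto simp: F_def inj_on_def)
  define W where "W = sym_graph (f ` F) (map_prod f f ` S)"
  have "digraph_iso (with_proj H) (with_proj W)"
    unfolding H_def W_def using S \<open>inj_on f F\<close> by (intro digraph_iso_sym_graph)
  moreover have "K12_K1 W \<or> K12_K1_plus_edge W \<or> K13_plus_edge W"
  proof -
    have "X \<in> {{}, {(a, b)}, {(a, d)}, {(b, d)}, {(c, d)}, {(a, d), (c, d)}, {(b, d), (c, d)}}"
      using cases unfolding X_def
      by (cases "(a, b) \<in> parcs G"; cases "(a, d) \<in> parcs G"; cases "(b, d) \<in> parcs G";
          cases "(c, d) \<in> parcs G"; simp)
    moreover have "W = sym_graph {0, 1, 2, 3} ({(2, 0), (2, 1)} \<union> map_prod f f ` X)"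
      using f by (auto simp: W_def S_def F_def image_Un)
    moreover have "K12_K1 (sym_graph {0, 1, 2, 3::nat} {(2, 0), (2, 1)})"
      by (rule K12_K1_sym_graph) simp
    moreover have "\<forall>e \<in> {(0, 1), (0, 3), (1, 3), (2, 3)}.
        K12_K1_plus_edge (sym_graph {0, 1, 2, 3::nat} {e, (2, 0), (2, 1)})"
      by (intro ballI K12_K1_plus_edge_sym_graph) simp_all
    moreover have "\<forall>e \<in> {(0, 3), (1, 3)}.
        K13_plus_edge (sym_graph {0, 1, 2, 3::nat} {e, (2, 0), (2, 1), (2, 3)})"
      by (intro ballI K13_plus_edge_sym_graph) simp_all
    ultimately show ?thesis
      using f by (elim insertE emptyE) (simp_all add: insert_commute)
  qed
  moreover have "pverts H = {a, b, c, d}" "parcs H \<subseteq> parcs G"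
    using arcs_H verts_H by (auto simp: F_def)
  ultimately show ?thesis
    by blast
qed

section \<open>Hamiltonicity from the local condition\<close>

theorem corollary1:
  fixes G :: "'a pair_pre_digraph" and n :: nat
  assumes "pair_graph G"
    and "card (pverts G) = n"
    and "n \<ge> 4"
    and "\<And>(H :: 'a pair_pre_digraph) (W :: nat pair_pre_digraph) x y.
           \<lbrakk> induced_subgraph (with_proj H) (with_proj G);
             K12_K1 W \<or> K12_K1_plus_edge W \<or> K13_plus_edge W;
             digraph_iso (with_proj H) (with_proj W);
             x \<in> pverts H; y \<in> pverts H; x \<noteq> y; (x, y) \<notin> parcs H \<rbrakk>
           \<Longrightarrow> degree (with_proj G) x + degree (with_proj G) y \<ge> n"
    and "\<exists>v\<in>pverts G. degree (with_proj G) v \<ge> 2"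
  shows "hamiltonian (with_proj G)"
proof -
  interpret pair_graph G by fact
  define E where "E x y \<longleftrightarrow> (x, y) \<in> parcs G" for x y
  have degree: "degree (with_proj G) x = card {z \<in> pverts G. E x z}" for x
  proof -
    have "out_arcs (with_proj G) x = Pair x ` {z \<in> pverts G. E x z}"
      by (auto simp: out_arcs_def E_def dest: in_arcsD2)
    then show ?thesis
      by (simp add: out_degree_def card_image inj_on_def)
  qed
  have E: "symp E" "irreflp E"
    by (auto simp: E_def intro!: sympI irreflpI dest: arcs_symmetric no_loops')
  have four: "n \<le> card {z \<in> pverts G. E x z} + card {z \<in> pverts G. E y z}"
    if prems: "{a, b, c, d} \<subseteq> pverts G" "distinct [a, b, c, d]" "E c a" "E c b"
      "\<not> E a b \<and> \<not> (E a d \<and> E b d) \<or> E a b \<and> \<not> E a d \<and> \<not> E b d \<and> \<not> E c d"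
      "x \<in> {a, b, c, d}" "y \<in> {a, b, c, d}" "x \<noteq> y" "\<not> E x y" for a b c d x y
  proof -
    obtain H and W :: "nat pair_pre_digraph"
      where H: "induced_subgraph (with_proj H) (with_proj G)"
        "K12_K1 W \<or> K12_K1_plus_edge W \<or> K13_plus_edge W" "digraph_iso (with_proj H) (with_proj W)"
        "pverts H = {a, b, c, d}" "parcs H \<subseteq> parcs G"
      using four_vertices_induce_listed_graph[OF assms(1) prems(1,2)] prems(3-5) unfolding E_def by blast
    then show ?thesis
      using assms(4)[OF H(1-3), of x y] prems(6-9) by (auto simp: degree E_def)
  qed
  obtain v where v: "v \<in> pverts G" "card {z \<in> pverts G. E v z} \<ge> 2"
    using assms(5) by (auto simp: degree)
  have "card (pverts G) \<le> card {z \<in> pverts G. E x z} + card {z \<in> pverts G. E y z}"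
    if "x \<in> pverts G" "y \<in> pverts G" "x \<noteq> y" "\<not> E x y" for x y
  proof (rule ore_condition_if_local[OF _ _ E _ _ v that])
    show "finite (pverts G)" "4 \<le> card (pverts G)"
      using assms pair_finite_verts by auto
  qed (use four assms(2) in blast)+
  then obtain xs where "distinct xs" "set xs = pverts G" "successively E (xs @ [hd xs])"
    using ore[OF pair_finite_verts _ E] assms(2,3) by fastforce
  then show ?thesis
    using hamiltonian_if_cyclic_arrangement[of xs G] assms(2,3) unfolding E_def by fastforce
qed

end
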